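(* Let $R=\mathbb{R}[a,b]$ with $a^2+b^2=1$ be the coordinate ring of $\mathbb{S}^1$ (that is, $R$ is the polynomial ring over $\mathbb{R}$ in two variables modulo the relation $a^2+b^2=1$), and let $T$ be the affine surface over $\mathbb{R}$ with coordinate ring $$A=R[x,y]/\bigl(x^2+y^2-(a+2)^2\bigr),$$ where $R[x,y]$ is the polynomial ring in two variables over $R$. Then $T$ is not isomorphic to $\mathbb{S}^1\times\mathbb{S}^1$ as an algebraic variety over $\mathbb{R}$; that is, $A$ is not isomorphic as an $\mathbb{R}$-algebra to the coordinate ring $R\otimes_{\mathbb{R}}R$ of $\mathbb{S}^1\times\mathbb{S}^1$.
   Context: $\mathbb{S}^1$ denotes the real $1$-sphere viewed as an affine algebraic variety over $\mathbb{R}$, defined in $\mathbb{R}^2$ by $x_0^2+x_1^2=1$. Affine $\mathbb{R}$-varieties are identified with their coordinate rings, so isomorphism over $\mathbb{R}$ means isomorphism of coordinate rings as $\mathbb{R}$-algebras. *)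

theory Defs
  imports Complex_Main "HOL-Algebra.Algebra" "HOL-Algebra.Algebraic_Closure_Type"
    "HOL-Library.Poly_Mapping"
begin

section \<open>Algebras and their isomorphisms\<close>

definition algebra_of_hom :: "('a, 'm) ring_scheme \<Rightarrow> ('k \<Rightarrow> 'a) \<Rightarrow> ('k, 'a) module"
  where "algebra_of_hom A \<iota> =
    \<lparr>carrier = carrier A, monoid.mult = monoid.mult A, one = \<one>\<^bsub>A\<^esub>, ring.zero = \<zero>\<^bsub>A\<^esub>, add = add A,
     module.smult = (\<lambda>c x. \<iota> c \<otimes>\<^bsub>A\<^esub> x)\<rparr>"

text \<open>The quotient of \<open>P\<close> by the ideal \<open>I\<close>, as an algebra over the source of \<open>\<iota>\<close>,
  which is the structure map into \<open>P\<close>.\<close>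

definition quotient_algebra ::
    "('a, 'm) ring_scheme \<Rightarrow> ('k \<Rightarrow> 'a) \<Rightarrow> 'a set \<Rightarrow> ('k, 'a set) module"
  where "quotient_algebra P \<iota> I = algebra_of_hom (P Quot I) (\<lambda>c. I +>\<^bsub>P\<^esub> \<iota> c)"

definition algebra_iso ::
    "('k, 'r) ring_scheme \<Rightarrow> ('k, 'a, 'm) module_scheme \<Rightarrow> ('k, 'b, 'n) module_scheme \<Rightarrow> ('a \<Rightarrow> 'b) set"
  where "algebra_iso K A B =
    {h \<in> ring_iso A B. \<forall>c\<in>carrier K. \<forall>x\<in>carrier A. h (c \<odot>\<^bsub>A\<^esub> x) = c \<odot>\<^bsub>B\<^esub> h x}"

lemma cring_algebra_of_hom:
  assumes "cring A"
  shows "cring (algebra_of_hom A \<iota>)"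
proof -
  interpret cring A by fact
  have "\<exists>y\<in>carrier A. y \<oplus>\<^bsub>A\<^esub> x = \<zero>\<^bsub>A\<^esub>" if "x \<in> carrier A" for x
    using that l_neg a_inv_closed by blast
  then show ?thesis
    by (intro cringI abelian_groupI comm_monoidI)
       (auto simp: algebra_of_hom_def a_ac m_assoc l_distr, fact m_comm)
qed

lemma algebra_algebra_of_hom:
  assumes "cring K" "cring A" "\<iota> \<in> ring_hom K A"
  shows "algebra K (algebra_of_hom A \<iota>)"
proof -
  interpret K: cring K by fact
  interpret A: cring A by fact
  note hom = ring_hom_closed[OF assms(3)] ring_hom_mult[OF assms(3)]
    ring_hom_add[OF assms(3)] ring_hom_one[OF assms(3)]
  show ?thesis
    by (rule algebraI[OF assms(1) cring_algebra_of_hom[OF assms(2)]])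
       (auto simp: algebra_of_hom_def hom A.l_distr A.r_distr A.m_assoc)
qed

lemma algebra_quotient_algebra:
  assumes "cring K" "cring P" "\<iota> \<in> ring_hom K P" "ideal I P"
  shows "algebra K (quotient_algebra P \<iota> I)"
proof -
  interpret ideal I P by fact
  have "(\<lambda>c. I +>\<^bsub>P\<^esub> \<iota> c) \<in> ring_hom K (P Quot I)"
    using ring_hom_trans[OF assms(3) rcos_ring_hom] by (simp add: comp_def)
  then show ?thesis
    unfolding quotient_algebra_def
    by (intro algebra_algebra_of_hom assms quotient_is_cring)
qed


section \<open>Tensor products of algebras\<close>

definition monoid_algebra :: "('g, 'm) monoid_scheme \<Rightarrow> ('g \<Rightarrow>\<^sub>0 'k::comm_ring_1) ring"
  where "monoid_algebra G =
    \<lparr>carrier = {f. Poly_Mapping.keys f \<subseteq> carrier G},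
     monoid.mult = (\<lambda>f g. \<Sum>x\<in>Poly_Mapping.keys f. \<Sum>y\<in>Poly_Mapping.keys g.
       Poly_Mapping.single (x \<otimes>\<^bsub>G\<^esub> y) (Poly_Mapping.lookup f x * Poly_Mapping.lookup g y)),
     one = Poly_Mapping.single \<one>\<^bsub>G\<^esub> 1,
     ring.zero = 0,
     add = (+)\<rparr>"

text \<open>As a module the monoid algebra of \<open>A \<times> B\<close> is the free module on that set, and multiplying
  one of the relations below by a basis element gives such a relation again. So the ideal
  generated by the relations is the submodule they generate.\<close>

definition tensor_relations ::
    "('k::comm_ring_1, 'a, 'm) module_scheme \<Rightarrow> ('k, 'b, 'n) module_scheme \<Rightarrow> ('a \<times> 'b \<Rightarrow>\<^sub>0 'k) set"
  where "tensor_relations A B =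
    {Poly_Mapping.single (x \<oplus>\<^bsub>A\<^esub> x', y) 1 - Poly_Mapping.single (x, y) 1 - Poly_Mapping.single (x', y) 1
      | x x' y. x \<in> carrier A \<and> x' \<in> carrier A \<and> y \<in> carrier B} \<union>
    {Poly_Mapping.single (x, y \<oplus>\<^bsub>B\<^esub> y') 1 - Poly_Mapping.single (x, y) 1 - Poly_Mapping.single (x, y') 1
      | x y y'. x \<in> carrier A \<and> y \<in> carrier B \<and> y' \<in> carrier B} \<union>
    {Poly_Mapping.single (c \<odot>\<^bsub>A\<^esub> x, y) 1 - Poly_Mapping.single (x, y) c
      | c x y. x \<in> carrier A \<and> y \<in> carrier B} \<union>
    {Poly_Mapping.single (x, c \<odot>\<^bsub>B\<^esub> y) 1 - Poly_Mapping.single (x, y) c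
      | c x y. x \<in> carrier A \<and> y \<in> carrier B}"

definition tensor_algebra ::
    "('k::comm_ring_1, 'a, 'm) module_scheme \<Rightarrow> ('k, 'b, 'n) module_scheme
      \<Rightarrow> ('k, ('a \<times> 'b \<Rightarrow>\<^sub>0 'k) set) module"
  where "tensor_algebra A B =
    quotient_algebra (monoid_algebra (A \<times>\<times> B))
      (\<lambda>c. Poly_Mapping.single (\<one>\<^bsub>A\<^esub>, \<one>\<^bsub>B\<^esub>) c)
      (Idl\<^bsub>monoid_algebra (A \<times>\<times> B)\<^esub> (tensor_relations A B))"

lemma keys_sum_subset:
  fixes b :: "'i \<Rightarrow> ('g \<Rightarrow>\<^sub>0 'k::comm_ring_1)"
  shows "Poly_Mapping.keys (sum b I) \<subseteq> (\<Union>i\<in>I. Poly_Mapping.keys (b i))"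
proof (induction I rule: infinite_finite_induct)
  case (insert i I)
  then show ?case using Poly_Mapping.keys_add[of "b i" "sum b I"] by auto
qed auto

lemma keys_uminus_eq:
  fixes f :: "'g \<Rightarrow>\<^sub>0 'k::comm_ring_1"
  shows "Poly_Mapping.keys (- f) = Poly_Mapping.keys f"
  by (auto simp: in_keys_iff)

lemma sum_single_lookup:
  fixes f :: "'g \<Rightarrow>\<^sub>0 'k::comm_ring_1"
  shows "(\<Sum>x\<in>Poly_Mapping.keys f. Poly_Mapping.single x (Poly_Mapping.lookup f x)) = f"
proof (rule poly_mapping_eqI)
  fix k
  show "Poly_Mapping.lookup (\<Sum>x\<in>Poly_Mapping.keys f. Poly_Mapping.single x (Poly_Mapping.lookup f x)) k = Poly_Mapping.lookup f k"
    by (simp add: lookup_sum lookup_single when_def in_keys_iff)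
qed

context
  fixes G (structure) and conv :: "('g \<Rightarrow>\<^sub>0 'k::comm_ring_1) \<Rightarrow> ('g \<Rightarrow>\<^sub>0 'k) \<Rightarrow> ('g \<Rightarrow>\<^sub>0 'k)"
  assumes G: "comm_monoid G"
  defines "conv \<equiv> monoid.mult (monoid_algebra G)"
begin

interpretation comm_monoid G by (rule G)

private lemma conv_eq:
  assumes "finite S" "finite T" "Poly_Mapping.keys f \<subseteq> S" "Poly_Mapping.keys g \<subseteq> T"
  shows "conv f g = (\<Sum>x\<in>S. \<Sum>y\<in>T.
    Poly_Mapping.single (x \<otimes> y) (Poly_Mapping.lookup f x * Poly_Mapping.lookup g y))"
proof -
  have "conv f g = (\<Sum>x\<in>Poly_Mapping.keys f. \<Sum>y\<in>T.
      Poly_Mapping.single (x \<otimes> y) (Poly_Mapping.lookup f x * Poly_Mapping.lookup g y))"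
    unfolding conv_def monoid_algebra_def
    using assms by (simp, intro sum.cong refl sum.mono_neutral_left)
      (auto simp: not_in_keys_iff_lookup_eq_zero)
  also have "\<dots> = (\<Sum>x\<in>S. \<Sum>y\<in>T.
      Poly_Mapping.single (x \<otimes> y) (Poly_Mapping.lookup f x * Poly_Mapping.lookup g y))"
    using assms by (intro sum.mono_neutral_left) (auto simp: not_in_keys_iff_lookup_eq_zero)
  finally show ?thesis .
qed

private lemma conv_add_left: "conv (f + f') g = conv f g + conv f' g"
  using conv_eq[of "Poly_Mapping.keys f \<union> Poly_Mapping.keys f'" "Poly_Mapping.keys g" f g]
    conv_eq[of "Poly_Mapping.keys f \<union> Poly_Mapping.keys f'" "Poly_Mapping.keys g" f' g]
    conv_eq[of "Poly_Mapping.keys f \<union> Poly_Mapping.keys f'" "Poly_Mapping.keys g" "f + f'" g]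
  by (simp add: Poly_Mapping.keys_add lookup_add distrib_right single_add sum.distrib)

private lemma conv_add_right: "conv g (f + f') = conv g f + conv g f'"
  using conv_eq[of "Poly_Mapping.keys g" "Poly_Mapping.keys f \<union> Poly_Mapping.keys f'" g f]
    conv_eq[of "Poly_Mapping.keys g" "Poly_Mapping.keys f \<union> Poly_Mapping.keys f'" g f']
    conv_eq[of "Poly_Mapping.keys g" "Poly_Mapping.keys f \<union> Poly_Mapping.keys f'" g "f + f'"]
  by (simp add: Poly_Mapping.keys_add lookup_add distrib_left single_add sum.distrib)

private lemma conv_zero: "conv 0 g = 0" "conv g 0 = 0"
  by (simp_all add: conv_def monoid_algebra_def)

private lemma conv_single:
  "conv (Poly_Mapping.single x c) (Poly_Mapping.single y d) = Poly_Mapping.single (x \<otimes> y) (c * d)"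
  by (subst conv_eq[of "{x}" "{y}"]) auto

private lemma conv_sum_left: "conv (\<Sum>i\<in>I. f i) g = (\<Sum>i\<in>I. conv (f i) g)"
  by (induction I rule: infinite_finite_induct) (auto simp: conv_zero conv_add_left)

private lemma conv_sum_right: "conv g (\<Sum>i\<in>I. f i) = (\<Sum>i\<in>I. conv g (f i))"
  by (induction I rule: infinite_finite_induct) (auto simp: conv_zero conv_add_right)

private lemma conv_assoc:
  assumes "Poly_Mapping.keys f \<subseteq> carrier G" "Poly_Mapping.keys g \<subseteq> carrier G"
    "Poly_Mapping.keys h \<subseteq> carrier G"
  shows "conv (conv f g) h = conv f (conv g h)"
proof -
  let ?exp = "\<lambda>f. \<Sum>x\<in>Poly_Mapping.keys f. Poly_Mapping.single x (Poly_Mapping.lookup f x)"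
  have 1: "conv (conv (Poly_Mapping.single x c) (Poly_Mapping.single y d)) (?exp h) =
      conv (Poly_Mapping.single x c) (conv (Poly_Mapping.single y d) (?exp h))"
    if "x \<in> carrier G" "y \<in> carrier G" for x y c d
    unfolding conv_sum_right conv_single
    using that assms by (intro sum.cong refl) (auto simp: m_assoc mult.assoc subset_iff)
  have 2: "conv (conv (Poly_Mapping.single x c) (?exp g)) h =
      conv (Poly_Mapping.single x c) (conv (?exp g) h)"
    if "x \<in> carrier G" for x c
    unfolding conv_sum_right conv_sum_left
    using that assms 1 by (intro sum.cong refl) (auto simp: sum_single_lookup subset_iff)
  have "conv (conv (?exp f) g) h = conv (?exp f) (conv g h)"
    unfolding conv_sum_left
    using assms 2 by (intro sum.cong refl) (auto simp: sum_single_lookup subset_iff)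
  then show ?thesis by (simp add: sum_single_lookup)
qed

private lemma conv_comm:
  assumes "Poly_Mapping.keys f \<subseteq> carrier G" "Poly_Mapping.keys g \<subseteq> carrier G"
  shows "conv f g = conv g f"
  unfolding conv_def monoid_algebra_def using assms
  by (simp, subst sum.swap, intro sum.cong refl) (auto simp: m_comm mult.commute subset_iff)

private lemma conv_one:
  assumes "Poly_Mapping.keys f \<subseteq> carrier G"
  shows "conv (Poly_Mapping.single \<one> 1) f = f"
proof -
  have "conv (Poly_Mapping.single \<one> 1)
      (\<Sum>x\<in>Poly_Mapping.keys f. Poly_Mapping.single x (Poly_Mapping.lookup f x)) =
    (\<Sum>x\<in>Poly_Mapping.keys f. Poly_Mapping.single x (Poly_Mapping.lookup f x))"
    unfolding conv_sum_right conv_single using assms by (intro sum.cong refl) auto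
  then show ?thesis unfolding sum_single_lookup .
qed

private lemma conv_closed:
  assumes "Poly_Mapping.keys f \<subseteq> carrier G" "Poly_Mapping.keys g \<subseteq> carrier G"
  shows "Poly_Mapping.keys (conv f g) \<subseteq> carrier G"
proof -
  have "Poly_Mapping.keys (conv f g) \<subseteq> (\<Union>x\<in>Poly_Mapping.keys f. \<Union>y\<in>Poly_Mapping.keys g. {x \<otimes> y})"
    unfolding conv_def monoid_algebra_def
    by (fastforce dest!: subsetD[OF keys_sum_subset] split: if_splits)
  also have "\<dots> \<subseteq> carrier G" using assms by auto
  finally show ?thesis .
qed

lemma cring_monoid_algebra: "cring (monoid_algebra G :: ('g \<Rightarrow>\<^sub>0 'k) ring)"
proof -
  have simps: "carrier (monoid_algebra G) = {f :: 'g \<Rightarrow>\<^sub>0 'k. Poly_Mapping.keys f \<subseteq> carrier G}"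
    "monoid.mult (monoid_algebra G) = conv" "ring.zero (monoid_algebra G) = (0 :: 'g \<Rightarrow>\<^sub>0 'k)"
    "one (monoid_algebra G) = (Poly_Mapping.single \<one> 1 :: 'g \<Rightarrow>\<^sub>0 'k)"
    "add (monoid_algebra G) = ((+) :: ('g \<Rightarrow>\<^sub>0 'k) \<Rightarrow> _)"
    by (simp_all add: monoid_algebra_def conv_def)
  show ?thesis
  proof (intro cringI abelian_groupI comm_monoidI, unfold simps mem_Collect_eq)
    fix f :: "'g \<Rightarrow>\<^sub>0 'k" assume f: "Poly_Mapping.keys f \<subseteq> carrier G"
    then show "\<exists>y\<in>{f. Poly_Mapping.keys f \<subseteq> carrier G}. y + f = 0"
      by (intro bexI[of _ "- f"]) (auto simp: keys_uminus_eq)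
  next
    fix f g :: "'g \<Rightarrow>\<^sub>0 'k"
    assume "Poly_Mapping.keys f \<subseteq> carrier G" "Poly_Mapping.keys g \<subseteq> carrier G"
    then show "Poly_Mapping.keys (f + g) \<subseteq> carrier G"
      using Poly_Mapping.keys_add[of f g] by auto
  qed (simp_all add: conv_closed conv_add_left conv_one conv_assoc add_ac, fact conv_comm)
qed

end

lemma monoid_algebra_mult_single:
  "Poly_Mapping.single x c \<otimes>\<^bsub>monoid_algebra G\<^esub> Poly_Mapping.single y d =
    Poly_Mapping.single (x \<otimes>\<^bsub>G\<^esub> y) (c * d)"
  by (auto simp: monoid_algebra_def)

lemma tensor_relations_closed:
  assumes "algebra ring_of_type_algebra A" "algebra ring_of_type_algebra B"
  shows "tensor_relations A B \<subseteq> carrier (monoid_algebra (A \<times>\<times> B) :: (_ \<Rightarrow>\<^sub>0 'k::comm_ring_1) ring)"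
proof -
  interpret A: algebra "ring_of_type_algebra :: 'k ring" A by fact
  interpret B: algebra "ring_of_type_algebra :: 'k ring" B by fact
  have [simp]: "c \<in> carrier ring_of_type_algebra" for c :: 'k
    by (simp add: ring_of_type_algebra_def)
  have diff: "Poly_Mapping.keys (f - g) \<subseteq> S"
    if "Poly_Mapping.keys f \<subseteq> S" "Poly_Mapping.keys g \<subseteq> S" for f g :: "'x \<Rightarrow>\<^sub>0 'k" and S
    using Poly_Mapping.keys_add[of f "- g"] that by (auto simp: keys_uminus_eq)
  have single: "Poly_Mapping.keys (Poly_Mapping.single x c) \<subseteq> S" if "x \<in> S"
    for x :: 'x and c :: 'k and S
    using that by simp
  show ?thesis
    unfolding tensor_relations_def monoid_algebra_def DirProd_def
    by (intro Un_least subsetI; elim CollectE exE conjE; simp del: keys_single;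
        intro diff single; simp)
qed

lemma algebra_tensor_algebra:
  fixes A :: "('k::comm_ring_1, 'a, 'm) module_scheme" and B :: "('k, 'b, 'n) module_scheme"
  assumes A: "algebra ring_of_type_algebra A" and B: "algebra ring_of_type_algebra B"
  shows "algebra ring_of_type_algebra (tensor_algebra A B)"
proof -
  interpret A: algebra "ring_of_type_algebra :: 'k ring" A by fact
  interpret B: algebra "ring_of_type_algebra :: 'k ring" B by fact
  have "comm_monoid (A \<times>\<times> B)"
    by (intro comm_monoidI)
      (auto simp: DirProd_def A.m_assoc B.m_assoc intro: A.m_comm B.m_comm)
  then have cring: "cring (monoid_algebra (A \<times>\<times> B) :: (_ \<Rightarrow>\<^sub>0 'k) ring)"
    by (rule cring_monoid_algebra)
  have "(\<lambda>c. Poly_Mapping.single (\<one>\<^bsub>A\<^esub>, \<one>\<^bsub>B\<^esub>) c) \<in>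
      ring_hom (ring_of_type_algebra :: 'k ring) (monoid_algebra (A \<times>\<times> B))"
    by (intro ring_hom_memI)
      (auto simp: monoid_algebra_mult_single, auto simp: monoid_algebra_def ring_of_type_algebra_def
        DirProd_def single_add)
  then show ?thesis
    unfolding tensor_algebra_def using cring
    by (intro algebra_quotient_algebra ring.genideal_ideal cring.axioms(1)
        tensor_relations_closed A B cring_from_type_algebra)
qed


section \<open>Polynomials in two variables\<close>

text \<open>The first variable and the coefficients live in the inner ring \<open>UP R\<close>, the second variable is
  the outer one.\<close>

definition UP2 :: "('a, 'm) ring_scheme \<Rightarrow> (nat \<Rightarrow> 'a, nat \<Rightarrow> nat \<Rightarrow> 'a) up_ring"
  where "UP2 R = UP (UP R)"

definition UP2_const :: "('a, 'm) ring_scheme \<Rightarrow> 'a \<Rightarrow> nat \<Rightarrow> nat \<Rightarrow> 'a"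
  where "UP2_const R c = up_ring.monom (UP2 R) (up_ring.monom (UP R) c 0) 0"

definition UP2_fst :: "('a, 'm) ring_scheme \<Rightarrow> nat \<Rightarrow> nat \<Rightarrow> 'a"
  where "UP2_fst R = up_ring.monom (UP2 R) (up_ring.monom (UP R) \<one>\<^bsub>R\<^esub> 1) 0"

definition UP2_snd :: "('a, 'm) ring_scheme \<Rightarrow> nat \<Rightarrow> nat \<Rightarrow> 'a"
  where "UP2_snd R = up_ring.monom (UP2 R) \<one>\<^bsub>UP R\<^esub> 1"

lemma cring_UP2: "cring R \<Longrightarrow> cring (UP2 R)"
  unfolding UP2_def by (intro UP_cring.UP_cring UP_cring.intro)

lemma UP2_const_hom:
  assumes "cring R"
  shows "UP2_const R \<in> ring_hom R (UP2 R)"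
proof -
  have 1: "ring R" using assms by (rule cring.axioms)
  have 2: "ring (UP R)" by (rule UP_ring.UP_ring[OF UP_ring.intro[OF 1]])
  from ring_hom_trans[OF UP_ring.const_ring_hom[OF UP_ring.intro[OF 1]]
      UP_ring.const_ring_hom[OF UP_ring.intro[OF 2]]]
  show ?thesis by (simp add: UP2_const_def[abs_def] UP2_def comp_def)
qed

lemma UP2_vars_closed:
  assumes "cring R"
  shows "UP2_fst R \<in> carrier (UP2 R)" "UP2_snd R \<in> carrier (UP2 R)"
proof -
  interpret R: UP_cring R "UP R" by (simp_all add: UP_cring.intro assms)
  interpret P: UP_cring "UP R" "UP (UP R)" by (simp_all add: UP_cring.intro R.UP_cring)
  show "UP2_fst R \<in> carrier (UP2 R)" "UP2_snd R \<in> carrier (UP2 R)"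
    by (simp_all add: UP2_fst_def UP2_snd_def UP2_def)
qed


section \<open>The circle and the surface\<close>

abbreviation real_ring :: "real ring"
  where "real_ring \<equiv> ring_of_type_algebra"

definition circle_polynomial :: "nat \<Rightarrow> nat \<Rightarrow> real"
  where "circle_polynomial =
    (let P = UP2 real_ring; a = UP2_fst real_ring; b = UP2_snd real_ring
     in a [^]\<^bsub>P\<^esub> (2::nat) \<oplus>\<^bsub>P\<^esub> b [^]\<^bsub>P\<^esub> (2::nat) \<ominus>\<^bsub>P\<^esub> \<one>\<^bsub>P\<^esub>)"

definition circle_algebra :: "(real, (nat \<Rightarrow> nat \<Rightarrow> real) set) module"
  where "circle_algebra = quotient_algebra (UP2 real_ring) (UP2_const real_ring)
    (PIdl\<^bsub>UP2 real_ring\<^esub> circle_polynomial)"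

definition circle_a :: "(nat \<Rightarrow> nat \<Rightarrow> real) set"
  where "circle_a = (PIdl\<^bsub>UP2 real_ring\<^esub> circle_polynomial) +>\<^bsub>UP2 real_ring\<^esub> UP2_fst real_ring"

definition surface_polynomial :: "nat \<Rightarrow> nat \<Rightarrow> (nat \<Rightarrow> nat \<Rightarrow> real) set"
  where "surface_polynomial =
    (let R = circle_algebra; P = UP2 R; x = UP2_fst R; y = UP2_snd R; two = \<one>\<^bsub>R\<^esub> \<oplus>\<^bsub>R\<^esub> \<one>\<^bsub>R\<^esub>
     in x [^]\<^bsub>P\<^esub> (2::nat) \<oplus>\<^bsub>P\<^esub> y [^]\<^bsub>P\<^esub> (2::nat)
       \<ominus>\<^bsub>P\<^esub> UP2_const R (circle_a \<oplus>\<^bsub>R\<^esub> two) [^]\<^bsub>P\<^esub> (2::nat))"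

definition surface_algebra :: "(real, (nat \<Rightarrow> nat \<Rightarrow> (nat \<Rightarrow> nat \<Rightarrow> real) set) set) module"
  where "surface_algebra = quotient_algebra (UP2 circle_algebra)
    (\<lambda>c. UP2_const circle_algebra (c \<odot>\<^bsub>circle_algebra\<^esub> \<one>\<^bsub>circle_algebra\<^esub>))
    (PIdl\<^bsub>UP2 circle_algebra\<^esub> surface_polynomial)"

lemma circle_polynomial_closed: "circle_polynomial \<in> carrier (UP2 real_ring)"
proof -
  interpret P: cring "UP2 real_ring" by (intro cring_UP2 cring_from_type_algebra)
  show ?thesis
    using UP2_vars_closed[OF cring_from_type_algebra[where 'a = real]]
    by (simp add: circle_polynomial_def Let_def)
qed

lemma algebra_circle_algebra: "algebra real_ring circle_algebra"
  unfolding circle_algebra_def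
  by (intro algebra_quotient_algebra UP2_const_hom cring.cgenideal_ideal cring_UP2
      cring_from_type_algebra circle_polynomial_closed)

lemma circle_a_closed: "circle_a \<in> carrier circle_algebra"
  using UP2_vars_closed(1)[OF cring_from_type_algebra[where 'a = real]]
  by (auto simp: circle_a_def circle_algebra_def quotient_algebra_def algebra_of_hom_def
      FactRing_simps)

lemma surface_polynomial_closed: "surface_polynomial \<in> carrier (UP2 circle_algebra)"
proof -
  interpret R: algebra real_ring circle_algebra by (rule algebra_circle_algebra)
  interpret P: cring "UP2 circle_algebra" by (intro cring_UP2 R.M_cring)
  show ?thesis
    using UP2_vars_closed[OF R.M_cring] circle_a_closed ring_hom_closed[OF UP2_const_hom[OF R.M_cring]]
    by (simp add: surface_polynomial_def Let_def)
qed

lemma algebra_surface_algebra: "algebra real_ring surface_algebra"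
proof -
  interpret R: algebra real_ring circle_algebra by (rule algebra_circle_algebra)
  have "(\<lambda>c. c \<odot>\<^bsub>circle_algebra\<^esub> \<one>\<^bsub>circle_algebra\<^esub>) \<in> ring_hom real_ring circle_algebra"
    by (rule ring_hom_memI)
      (simp_all add: R.smult_l_distr R.smult_assoc1 R.smult_assoc2)
  from ring_hom_trans[OF this UP2_const_hom[OF R.M_cring]] show ?thesis
    unfolding surface_algebra_def
    by (intro algebra_quotient_algebra cring.cgenideal_ideal cring_UP2 R.M_cring
      cring_from_type_algebra surface_polynomial_closed) (simp add: comp_def)
qed

end

theory Submission
  imports Defs "HOL-Analysis.Determinants"
begin

text \<open>
  The surface is singular at the complex point \<open>a = -2\<close>, \<open>b = \<i> \<surd>3\<close>, \<open>x = y = 0\<close>, while the product of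
  two circles is smooth. Tangent directions are read off from homomorphisms into the square-zero
  extension of \<open>\<complex>\<close> by \<open>\<complex>\<^sup>3\<close>. At the singular point there is a homomorphism from the coordinate ring of
  the surface whose tangent parts span \<open>\<complex>\<^sup>3\<close>. On the other hand, the relation \<open>a\<^sup>2 + b\<^sup>2 = 1\<close> makes the
  tangent parts of the two generators of a circle proportional, so for every homomorphism from the
  coordinate ring of the product some nonzero linear form kills the tangent parts of all four
  generators, hence of all elements.
\<close>

section \<open>Universal properties of quotients and of polynomial rings in two variables\<close>

lemma FactRing_hom_exists:
  assumes "ideal I P" "ring S" "f \<in> ring_hom P S" "\<And>i. i \<in> I \<Longrightarrow> f i = \<zero>\<^bsub>S\<^esub>"
  shows "\<exists>F\<in>ring_hom (P Quot I) S. \<forall>p\<in>carrier P. F (I +>\<^bsub>P\<^esub> p) = f p"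
proof -
  interpret ideal I P by fact
  interpret S: ring S by fact
  interpret f: ring_hom_ring P S f
    by (intro ring_hom_ringI2 assms ring_axioms S.ring_axioms)
  \<comment> \<open>As \<open>f\<close> vanishes on \<open>I\<close>, it is constant on each coset,
    so the image of a coset is a singleton and \<open>the_elem\<close> extracts its value without a
    choice of representative.\<close>
  define F where "F Z = the_elem (f ` Z)" for Z
  have F: "F (I +>\<^bsub>P\<^esub> p) = f p" if "p \<in> carrier P" for p
  proof -
    have "f ` (I +>\<^bsub>P\<^esub> p) = {f p}"
    proof
      show "f ` (I +>\<^bsub>P\<^esub> p) \<subseteq> {f p}"
        using that assms(4) a_Hcarr by (auto simp: a_r_coset_def')
      show "{f p} \<subseteq> f ` (I +>\<^bsub>P\<^esub> p)"
        using a_rcos_self[OF that] by auto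
    qed
    then show ?thesis by (simp add: F_def)
  qed
  have F_hom: "F \<in> ring_hom (P Quot I) S"
  proof (rule ring_hom_memI)
    fix Z Y assume "Z \<in> carrier (P Quot I)" "Y \<in> carrier (P Quot I)"
    then obtain x y where *: "Z = I +>\<^bsub>P\<^esub> x" "Y = I +>\<^bsub>P\<^esub> y" "x \<in> carrier P" "y \<in> carrier P"
      by (auto simp: FactRing_def A_RCOSETS_def')
    show "F Z \<in> carrier S" by (simp add: * F)
    show "F (Z \<otimes>\<^bsub>P Quot I\<^esub> Y) = F Z \<otimes>\<^bsub>S\<^esub> F Y"
      using * by (simp flip: ring_hom_mult[OF rcos_ring_hom] add: F)
    show "F (Z \<oplus>\<^bsub>P Quot I\<^esub> Y) = F Z \<oplus>\<^bsub>S\<^esub> F Y"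
      using * by (simp flip: ring_hom_add[OF rcos_ring_hom] add: F)
  next
    show "F \<one>\<^bsub>P Quot I\<^esub> = \<one>\<^bsub>S\<^esub>"
      by (simp flip: ring_hom_one[OF rcos_ring_hom] add: F)
  qed
  with F show ?thesis by blast
qed

text \<open>Evaluation is done twice: the inner ring \<open>UP R\<close> is evaluated at
  \<open>s\<close>, and the resulting map serves as the coefficient homomorphism for evaluating the
  outer variable at \<open>t\<close>.\<close>

lemma UP2_hom_exists:
  assumes "cring R" "cring S" "\<phi> \<in> ring_hom R S" "s \<in> carrier S" "t \<in> carrier S"
  shows "\<exists>f\<in>ring_hom (UP2 R) S.
    (\<forall>c\<in>carrier R. f (UP2_const R c) = \<phi> c) \<and> f (UP2_fst R) = s \<and> f (UP2_snd R) = t"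
proof -
  interpret R: UP_pre_univ_prop R S \<phi> "UP R"
    using assms by (auto intro: UP_pre_univ_propI)
  let ?f = "eval R S \<phi> s"
  interpret P: UP_pre_univ_prop "UP R" S ?f "UP (UP R)"
    using assms R.UP_cring by (auto intro: UP_pre_univ_propI R.eval_ring_hom)
  let ?g = "eval (UP R) S ?f t"
  have "?g \<in> ring_hom (UP2 R) S"
    using assms by (simp add: UP2_def P.eval_ring_hom)
  moreover have "?g (UP2_const R c) = \<phi> c" if "c \<in> carrier R" for c
    using assms that by (simp add: UP2_const_def UP2_def P.eval_const R.eval_const)
  moreover have "?g (UP2_fst R) = s"
    using assms R.eval_monom1[of s] by (simp add: UP2_fst_def UP2_def P.eval_const)
  moreover have "?g (UP2_snd R) = t"
    using assms P.eval_monom1[of t] by (simp add: UP2_snd_def UP2_def)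
  ultimately show ?thesis by blast
qed

text \<open>Uniqueness for one variable is applied first to the restrictions to the inner ring
  \<open>UP R\<close>, embedded as constants, and then to the outer variable.\<close>

lemma UP2_hom_unique:
  assumes "cring R" "cring S" "f \<in> ring_hom (UP2 R) S" "g \<in> ring_hom (UP2 R) S"
    and "\<And>c. c \<in> carrier R \<Longrightarrow> f (UP2_const R c) = g (UP2_const R c)"
    and "f (UP2_fst R) = g (UP2_fst R)" "f (UP2_snd R) = g (UP2_snd R)"
    and "p \<in> carrier (UP2 R)"
  shows "f p = g p"
proof -
  interpret R: UP_cring R "UP R" by (simp_all add: UP_cring.intro assms)
  interpret P: UP_cring "UP R" "UP (UP R)" by (simp_all add: UP_cring.intro R.UP_cring)
  interpret S: cring S by fact
  have const: "(\<lambda>p. up_ring.monom (UP (UP R)) p 0) \<in> ring_hom (UP R) (UP2 R)"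
    using P.const_ring_hom by (simp add: UP2_def)
  have inner: "f (up_ring.monom (UP (UP R)) q 0) = g (up_ring.monom (UP (UP R)) q 0)"
    if q: "q \<in> carrier (UP R)" for q
  proof -
    let ?F = "\<lambda>h p. h (up_ring.monom (UP (UP R)) p 0)"
    have hom: "?F h \<in> ring_hom (UP R) S" if "h \<in> ring_hom (UP2 R) S" for h
      using ring_hom_trans[OF const that] by (simp add: comp_def)
    have homc: "ring_hom_cring (UP R) S (?F h)" if "h \<in> ring_hom (UP2 R) S" for h
      by (intro ring_hom_cring.intro ring_hom_cring_axioms.intro R.UP_cring assms hom that)
    have "(\<lambda>c. g (UP2_const R c)) \<in> ring_hom R S"
      using ring_hom_trans[OF UP2_const_hom[OF assms(1)] assms(4)] by (simp add: comp_def)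
    \<comment> \<open>\<open>UP_hom_unique\<close> compares two extensions of one fixed coefficient
      homomorphism; the restriction of \<open>g\<close> is taken for it, and \<open>f\<close> agrees
      with it by assumption.\<close>
    then interpret U: UP_pre_univ_prop R S "\<lambda>c. g (UP2_const R c)" "UP R"
      using assms by (auto intro: UP_pre_univ_propI)
    show ?thesis
      by (rule U.UP_hom_unique[OF homc[OF assms(3)] _ _ homc[OF assms(4)] _ _ q,
            of "g (UP2_fst R)"])
        (use assms in \<open>auto simp: UP2_const_def UP2_fst_def UP2_def
            intro!: ring_hom_closed[OF assms(4)[unfolded UP2_def]]\<close>)
  qed
  have "(\<lambda>p. g (up_ring.monom (UP (UP R)) p 0)) \<in> ring_hom (UP R) S"
    using ring_hom_trans[OF const assms(4)] by (simp add: comp_def)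
  then interpret U: UP_pre_univ_prop "UP R" S "\<lambda>p. g (up_ring.monom (UP (UP R)) p 0)" "UP (UP R)"
    using assms R.UP_cring by (auto intro: UP_pre_univ_propI)
  have homc: "ring_hom_cring (UP (UP R)) S h" if "h \<in> ring_hom (UP2 R) S" for h
    using that by (intro ring_hom_cring.intro ring_hom_cring_axioms.intro P.UP_cring assms) (simp add: UP2_def)
  show ?thesis
    by (rule U.UP_hom_unique[OF homc[OF assms(3)] _ _ homc[OF assms(4)] _ _ assms(8)[unfolded UP2_def],
            of "g (UP2_snd R)"])
      (use assms inner in \<open>auto simp: UP2_snd_def UP2_def
            intro!: ring_hom_closed[OF assms(4)[unfolded UP2_def]]\<close>)
qed

section \<open>The square-zero extension and linear forms on its tangent part\<close>

text \<open>A pair \<open>(c, v)\<close> stands for \<open>c + v\<close> with all products of two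
  tangent parts zero. For a homomorphism into this ring the first component is a complex point and
  the second obeys the Leibniz rule there, so it collects one derivation for each
  coordinate.\<close>

definition thick_point :: "(complex \<times> (complex ^ 'n)) ring"
  where "thick_point = \<lparr>carrier = UNIV, monoid.mult = (\<lambda>(c, v) (d, w). (c * d, c *s w + d *s v)),
    one = (1, 0), ring.zero = (0, 0), add = (\<lambda>(c, v) (d, w). (c + d, v + w))\<rparr>"

lemma cring_thick_point: "cring (thick_point :: (complex \<times> (complex ^ 'n)) ring)"
proof -
  have "\<exists>d w. d + c = 0 \<and> w + v = 0" for c :: complex and v :: "complex ^ 'n"
    by (rule exI[of _ "- c"], rule exI[of _ "- v"]) simp
  then show ?thesis
    by (intro cringI abelian_groupI comm_monoidI)
      (auto simp: thick_point_def vec_eq_iff algebra_simps)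
qed

text \<open>The tangent part \<open>c *s w + d *s v\<close> of a product is linear in the tangent
  parts of the factors, so linear maps respect it. Comparing \<open>M\<close> with the zero matrix
  turns the claim that \<open>M\<close> kills tangent parts into an equality of two homomorphisms,
  which can be tested on generators.\<close>

lemma thick_point_linear_hom:
  "(\<lambda>(c, v). (c, M *v v)) \<in> ring_hom thick_point thick_point"
  by (rule ring_hom_memI)
    (auto simp: thick_point_def matrix_vector_right_distrib vector_scalar_commute)

text \<open>Two vectors span at most a plane in a space of dimension three. The form is a matrix
  with one row so that \<open>thick_point_linear_hom\<close> applies to it.\<close>

lemma exists_linear_form_vanishing:
  fixes v w :: "complex ^ 3"
  shows "\<exists>M :: complex ^ 3 ^ 1. M \<noteq> 0 \<and> M *v v = 0 \<and> M *v w = 0"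
proof -
  \<comment> \<open>The zero row makes the system square and singular; a nonzero kernel vector of
    \<open>N\<close> gives the coefficients of the form.\<close>
  define N :: "complex ^ 3 ^ 3" where "N = vector [v, w, 0]"
  have "det N = 0"
    by (rule det_zero_row(2)[of 3]) (simp add: N_def row_def vec_eq_iff)
  then obtain x where x: "x \<noteq> 0" "N *v x = 0"
    using invertible_det_nz[of N] matrix_left_invertible_ker[of N]
    by (auto simp: invertible_left_inverse)
  from x(2) have "(\<Sum>j\<in>UNIV. v $ j * x $ j) = 0" "(\<Sum>j\<in>UNIV. w $ j * x $ j) = 0"
    by (auto simp: N_def vec_eq_iff matrix_vector_mult_def forall_3)
  with x(1) show ?thesis
    by (intro exI[of _ "\<chi> i. x"]) (auto simp: vec_eq_iff matrix_vector_mult_def mult.commute)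
qed


section \<open>Homomorphisms and scalars of quotient algebras\<close>

lemma ring_hom_algebra_of_hom:
  "ring_hom (algebra_of_hom A \<iota>) S = ring_hom A S"
  "ring_hom S (algebra_of_hom A \<iota>) = ring_hom S A"
  by (simp_all add: ring_hom_def algebra_of_hom_def)

lemma quotient_algebra_proj_hom:
  assumes "ideal I P"
  shows "(+>\<^bsub>P\<^esub>) I \<in> ring_hom P (quotient_algebra P \<iota> I)"
  using ideal.rcos_ring_hom[OF assms] by (simp add: quotient_algebra_def ring_hom_algebra_of_hom)

lemma carrier_quotient_algebra: "carrier (quotient_algebra P \<iota> I) = (+>\<^bsub>P\<^esub>) I ` carrier P"
  by (auto simp: quotient_algebra_def algebra_of_hom_def FactRing_def A_RCOSETS_def')

lemma quotient_algebra_proj_eq_zero: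
  assumes "ideal I P" "i \<in> I"
  shows "I +>\<^bsub>P\<^esub> i = \<zero>\<^bsub>quotient_algebra P \<iota> I\<^esub>"
  using ring.a_rcos_zero[OF ideal.axioms(2) assms] assms(1)
  by (simp add: quotient_algebra_def algebra_of_hom_def FactRing_def)

lemma quotient_algebra_smult_one:
  assumes "ideal I P" "\<iota> c \<in> carrier P"
  shows "c \<odot>\<^bsub>quotient_algebra P \<iota> I\<^esub> \<one>\<^bsub>quotient_algebra P \<iota> I\<^esub> = I +>\<^bsub>P\<^esub> \<iota> c"
proof -
  interpret ideal I P by fact
  interpret Q: ring "P Quot I" by (rule quotient_is_ring)
  show ?thesis
    using ring_hom_closed[OF rcos_ring_hom assms(2)]
    by (simp add: quotient_algebra_def algebra_of_hom_def)
qed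

text \<open>Every element of the principal ideal is a multiple of \<open>g\<close>, so a
  homomorphism that kills \<open>g\<close> kills the ideal and factors through the quotient.\<close>

lemma quotient_algebra_hom_exists:
  assumes "cring P" "g \<in> carrier P" "cring S" "f \<in> ring_hom P S" "f g = \<zero>\<^bsub>S\<^esub>"
  shows "\<exists>F\<in>ring_hom (quotient_algebra P \<iota> (PIdl\<^bsub>P\<^esub> g)) S.
    \<forall>p\<in>carrier P. F ((PIdl\<^bsub>P\<^esub> g) +>\<^bsub>P\<^esub> p) = f p"
proof -
  interpret P: cring P by fact
  interpret S: cring S by fact
  have "f i = \<zero>\<^bsub>S\<^esub>" if "i \<in> PIdl\<^bsub>P\<^esub> g" for i
    using that assms
    by (auto simp: cgenideal_def ring_hom_mult[OF assms(4)] ring_hom_closed[OF assms(4)])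
  then show ?thesis
    using FactRing_hom_exists[OF P.cgenideal_ideal[OF assms(2)] S.ring_axioms assms(4)]
    by (simp add: quotient_algebra_def ring_hom_algebra_of_hom)
qed

section \<open>The coordinate ring of the circle\<close>

lemma cring_real_ring: "cring real_ring"
  by (rule cring_from_type_algebra)

lemma carrier_real_ring: "c \<in> carrier real_ring"
  by (simp add: ring_of_type_algebra_def)

lemma ring_hom_circle_polynomial:
  assumes "cring S" "f \<in> ring_hom (UP2 real_ring) S"
  shows "f circle_polynomial = f (UP2_fst real_ring) \<otimes>\<^bsub>S\<^esub> f (UP2_fst real_ring)
    \<oplus>\<^bsub>S\<^esub> f (UP2_snd real_ring) \<otimes>\<^bsub>S\<^esub> f (UP2_snd real_ring) \<ominus>\<^bsub>S\<^esub> \<one>\<^bsub>S\<^esub>"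
proof -
  interpret ring_hom_cring "UP2 real_ring" S f
    by (intro ring_hom_cring.intro ring_hom_cring_axioms.intro cring_UP2 cring_real_ring assms)
  show ?thesis
    using UP2_vars_closed[OF cring_real_ring]
    by (simp add: circle_polynomial_def Let_def numeral_2_eq_2 a_minus_def)
qed

definition circle_b :: "(nat \<Rightarrow> nat \<Rightarrow> real) set"
  where "circle_b = (PIdl\<^bsub>UP2 real_ring\<^esub> circle_polynomial) +>\<^bsub>UP2 real_ring\<^esub> UP2_snd real_ring"

lemma circle_ideal: "ideal (PIdl\<^bsub>UP2 real_ring\<^esub> circle_polynomial) (UP2 real_ring)"
  by (intro cring.cgenideal_ideal cring_UP2 cring_real_ring circle_polynomial_closed)

lemma cring_circle_algebra: "cring circle_algebra"
  using algebra_circle_algebra by (simp add: algebra_def)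

lemma circle_algebra_smult_one:
  "c \<odot>\<^bsub>circle_algebra\<^esub> \<one>\<^bsub>circle_algebra\<^esub>
    = (PIdl\<^bsub>UP2 real_ring\<^esub> circle_polynomial) +>\<^bsub>UP2 real_ring\<^esub> UP2_const real_ring c"
  unfolding circle_algebra_def
  by (intro quotient_algebra_smult_one circle_ideal carrier_real_ring
      ring_hom_closed[OF UP2_const_hom[OF cring_real_ring]])

lemma circle_b_closed: "circle_b \<in> carrier circle_algebra"
  using UP2_vars_closed(2)[OF cring_real_ring]
  by (simp add: circle_b_def circle_algebra_def carrier_quotient_algebra)

text \<open>This is the functor of points of the circle: once the scalars are mapped by
  \<open>\<kappa>\<close>, any solution of the circle equation in \<open>S\<close> is the image of
  the two coordinates. Scalars are written as multiples of the unit, a form that homomorphisms of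
  algebras preserve.\<close>

lemma circle_hom_exists:
  assumes "cring S" "\<kappa> \<in> ring_hom real_ring S" "s \<in> carrier S" "t \<in> carrier S"
    and "s \<otimes>\<^bsub>S\<^esub> s \<oplus>\<^bsub>S\<^esub> t \<otimes>\<^bsub>S\<^esub> t = \<one>\<^bsub>S\<^esub>"
  shows "\<exists>f\<in>ring_hom circle_algebra S.
    (\<forall>c. f (c \<odot>\<^bsub>circle_algebra\<^esub> \<one>\<^bsub>circle_algebra\<^esub>) = \<kappa> c) \<and> f circle_a = s \<and> f circle_b = t"
proof -
  interpret S: cring S by fact
  note closed = UP2_vars_closed[OF cring_real_ring]
    ring_hom_closed[OF UP2_const_hom[OF cring_real_ring] carrier_real_ring]
  obtain f where f: "f \<in> ring_hom (UP2 real_ring) S" "\<And>c. f (UP2_const real_ring c) = \<kappa> c"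
    "f (UP2_fst real_ring) = s" "f (UP2_snd real_ring) = t"
    using UP2_hom_exists[OF cring_real_ring assms(1-4)] carrier_real_ring by blast
  have "f circle_polynomial = \<zero>\<^bsub>S\<^esub>"
    using ring_hom_circle_polynomial[OF assms(1) f(1)] by (simp add: f assms S.minus_eq S.r_neg)
  from quotient_algebra_hom_exists[of _ circle_polynomial, OF cring_UP2[OF cring_real_ring]
      circle_polynomial_closed assms(1) f(1) this, of "UP2_const real_ring"]
  obtain F where F: "F \<in> ring_hom circle_algebra S" "\<And>p. p \<in> carrier (UP2 real_ring) \<Longrightarrow>
      F ((PIdl\<^bsub>UP2 real_ring\<^esub> circle_polynomial) +>\<^bsub>UP2 real_ring\<^esub> p) = f p"
    unfolding circle_algebra_def by blast
  show ?thesis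
    by (rule bexI[OF _ F(1)]) (simp add: circle_algebra_smult_one circle_a_def circle_b_def F(2) f closed)
qed

lemma circle_hom_relation:
  assumes "cring S" "f \<in> ring_hom circle_algebra S"
  shows "f circle_a \<otimes>\<^bsub>S\<^esub> f circle_a \<oplus>\<^bsub>S\<^esub> f circle_b \<otimes>\<^bsub>S\<^esub> f circle_b = \<one>\<^bsub>S\<^esub>"
proof -
  interpret S: cring S by fact
  interpret P: cring "UP2 real_ring" by (intro cring_UP2 cring_real_ring)
  let ?I = "PIdl\<^bsub>UP2 real_ring\<^esub> circle_polynomial"
  let ?p = "(+>\<^bsub>UP2 real_ring\<^esub>) ?I"
  have "?p \<in> ring_hom (UP2 real_ring) circle_algebra"
    unfolding circle_algebra_def by (intro quotient_algebra_proj_hom circle_ideal)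
  then have q: "f \<circ> ?p \<in> ring_hom (UP2 real_ring) S"
    using assms(2) by (rule ring_hom_trans)
  have "?p circle_polynomial = \<zero>\<^bsub>circle_algebra\<^esub>"
    unfolding circle_algebra_def
    by (intro quotient_algebra_proj_eq_zero circle_ideal P.cgenideal_self circle_polynomial_closed)
  moreover have "f \<zero>\<^bsub>circle_algebra\<^esub> = \<zero>\<^bsub>S\<^esub>"
    using ring_hom_zero[OF assms(2)] cring_circle_algebra S.ring_axioms by (simp add: cring_def)
  ultimately have "(f \<circ> ?p) circle_polynomial = \<zero>\<^bsub>S\<^esub>"
    by simp
  then have "f circle_a \<otimes>\<^bsub>S\<^esub> f circle_a \<oplus>\<^bsub>S\<^esub> f circle_b \<otimes>\<^bsub>S\<^esub> f circle_b \<ominus>\<^bsub>S\<^esub> \<one>\<^bsub>S\<^esub> = \<zero>\<^bsub>S\<^esub>"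
    using ring_hom_circle_polynomial[OF assms(1) q] by (simp add: circle_a_def circle_b_def)
  then show ?thesis
    using ring_hom_closed[OF assms(2)] circle_a_closed circle_b_closed by simp
qed

text \<open>The projection from the polynomial ring is onto, so it suffices to compare the
  composites with it, and these are determined by constants and variables.\<close>

lemma circle_hom_unique:
  assumes "cring S" "f \<in> ring_hom circle_algebra S" "g \<in> ring_hom circle_algebra S"
    and "\<And>c. f (c \<odot>\<^bsub>circle_algebra\<^esub> \<one>\<^bsub>circle_algebra\<^esub>) = g (c \<odot>\<^bsub>circle_algebra\<^esub> \<one>\<^bsub>circle_algebra\<^esub>)"
    and "f circle_a = g circle_a" "f circle_b = g circle_b"
    and "x \<in> carrier circle_algebra"
  shows "f x = g x"
proof -
  let ?p = "(+>\<^bsub>UP2 real_ring\<^esub>) (PIdl\<^bsub>UP2 real_ring\<^esub> circle_polynomial)"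
  have p: "?p \<in> ring_hom (UP2 real_ring) circle_algebra"
    unfolding circle_algebra_def by (intro quotient_algebra_proj_hom circle_ideal)
  obtain y where y: "y \<in> carrier (UP2 real_ring)" "x = ?p y"
    using assms(7) by (auto simp: circle_algebra_def carrier_quotient_algebra)
  have "(f \<circ> ?p) y = (g \<circ> ?p) y"
    by (rule UP2_hom_unique[OF cring_real_ring assms(1) ring_hom_trans[OF p assms(2)]
          ring_hom_trans[OF p assms(3)] _ _ _ y(1)])
      (use assms(4-6) in \<open>simp_all add: circle_algebra_smult_one circle_a_def circle_b_def\<close>)
  then show ?thesis by (simp add: y)
qed

section \<open>Homomorphisms out of the coordinate ring of the surface\<close>

text \<open>A homomorphism on the circle extends by any values of \<open>x\<close> and
  \<open>y\<close> that satisfy the surface equation. The conclusion speaks of the image of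
  \<open>F\<close> because the argument at the singular point asks which tangent parts are
  attained.\<close>

lemma surface_hom_exists:
  assumes "cring S" "\<kappa> \<in> ring_hom circle_algebra S" "s \<in> carrier S" "t \<in> carrier S"
    and "s \<otimes>\<^bsub>S\<^esub> s \<oplus>\<^bsub>S\<^esub> t \<otimes>\<^bsub>S\<^esub> t =
      (\<kappa> circle_a \<oplus>\<^bsub>S\<^esub> (\<one>\<^bsub>S\<^esub> \<oplus>\<^bsub>S\<^esub> \<one>\<^bsub>S\<^esub>)) \<otimes>\<^bsub>S\<^esub> (\<kappa> circle_a \<oplus>\<^bsub>S\<^esub> (\<one>\<^bsub>S\<^esub> \<oplus>\<^bsub>S\<^esub> \<one>\<^bsub>S\<^esub>))"
  shows "\<exists>F\<in>ring_hom surface_algebra S.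
    (\<forall>c. F (c \<odot>\<^bsub>surface_algebra\<^esub> \<one>\<^bsub>surface_algebra\<^esub>)
      = \<kappa> (c \<odot>\<^bsub>circle_algebra\<^esub> \<one>\<^bsub>circle_algebra\<^esub>)) \<and>
    \<kappa> ` carrier circle_algebra \<union> {s, t} \<subseteq> F ` carrier surface_algebra"
proof -
  let ?P = "UP2 circle_algebra"
  let ?J = "PIdl\<^bsub>?P\<^esub> surface_polynomial"
  interpret R: algebra real_ring circle_algebra by (rule algebra_circle_algebra)
  interpret S: cring S by fact
  interpret P: cring ?P by (intro cring_UP2 cring_circle_algebra)
  have J: "ideal ?J ?P"
    by (intro P.cgenideal_ideal surface_polynomial_closed)
  have unit: "c \<odot>\<^bsub>circle_algebra\<^esub> \<one>\<^bsub>circle_algebra\<^esub> \<in> carrier circle_algebra" for c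
    by (simp add: carrier_real_ring)
  note closed = UP2_vars_closed[OF cring_circle_algebra]
    ring_hom_closed[OF UP2_const_hom[OF cring_circle_algebra]]
  obtain f where f: "f \<in> ring_hom ?P S"
    "\<And>r. r \<in> carrier circle_algebra \<Longrightarrow> f (UP2_const circle_algebra r) = \<kappa> r"
    "f (UP2_fst circle_algebra) = s" "f (UP2_snd circle_algebra) = t"
    using UP2_hom_exists[OF cring_circle_algebra assms(1-4)] by blast
  interpret f: ring_hom_cring ?P S f
    by (intro ring_hom_cring.intro ring_hom_cring_axioms.intro P.is_cring assms f)
  have kappa_a: "\<kappa> circle_a \<in> carrier S"
    using ring_hom_closed[OF assms(2)] circle_a_closed by blast
  have "f surface_polynomial = \<zero>\<^bsub>S\<^esub>"
    using closed circle_a_closed assms(3-5) kappa_a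
    by (simp add: surface_polynomial_def Let_def numeral_2_eq_2 a_minus_def f
        ring_hom_add[OF assms(2)] ring_hom_one[OF assms(2)] S.r_neg)
  from quotient_algebra_hom_exists[of _ surface_polynomial, OF P.is_cring surface_polynomial_closed assms(1) f(1) this]
  obtain F where F: "F \<in> ring_hom surface_algebra S" "\<And>p. p \<in> carrier ?P \<Longrightarrow> F (?J +>\<^bsub>?P\<^esub> p) = f p"
    unfolding surface_algebra_def by blast
  have "f ` carrier ?P \<subseteq> F ` carrier surface_algebra"
    using F(2) by (force simp: surface_algebra_def carrier_quotient_algebra image_image)
  moreover have "\<kappa> ` carrier circle_algebra \<union> {s, t} \<subseteq> f ` carrier ?P"
    using f(2-4) closed by (force simp: image_iff)
  moreover have "c \<odot>\<^bsub>surface_algebra\<^esub> \<one>\<^bsub>surface_algebra\<^esub>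
      = ?J +>\<^bsub>?P\<^esub> UP2_const circle_algebra (c \<odot>\<^bsub>circle_algebra\<^esub> \<one>\<^bsub>circle_algebra\<^esub>)" for c
    unfolding surface_algebra_def
    by (rule quotient_algebra_smult_one[OF J]) (intro closed unit)
  then have "F (c \<odot>\<^bsub>surface_algebra\<^esub> \<one>\<^bsub>surface_algebra\<^esub>)
      = \<kappa> (c \<odot>\<^bsub>circle_algebra\<^esub> \<one>\<^bsub>circle_algebra\<^esub>)" for c
    by (simp only: F(2)[OF closed(3)[OF unit]] f(2)[OF unit])
  ultimately show ?thesis
    by (intro bexI[OF _ F(1)] conjI allI) (assumption, rule subset_trans)
qed

section \<open>Elementary tensors\<close>

definition pure_tensor :: "('k::comm_ring_1, 'a, 'm) module_scheme \<Rightarrow> ('k, 'b, 'n) module_scheme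
    \<Rightarrow> 'a \<Rightarrow> 'b \<Rightarrow> ('a \<times> 'b \<Rightarrow>\<^sub>0 'k) set"
  where "pure_tensor A B x y = Idl\<^bsub>monoid_algebra (A \<times>\<times> B)\<^esub> (tensor_relations A B)
    +>\<^bsub>monoid_algebra (A \<times>\<times> B)\<^esub> Poly_Mapping.single (x, y) 1"

context
  fixes A :: "('k::comm_ring_1, 'a, 'm) module_scheme" and B :: "('k, 'b, 'n) module_scheme"
    and P I T
  assumes A: "algebra ring_of_type_algebra A" and B: "algebra ring_of_type_algebra B"
  defines "P \<equiv> monoid_algebra (A \<times>\<times> B) :: ('a \<times> 'b \<Rightarrow>\<^sub>0 'k) ring"
    and "I \<equiv> Idl\<^bsub>monoid_algebra (A \<times>\<times> B) :: ('a \<times> 'b \<Rightarrow>\<^sub>0 'k) ring\<^esub> (tensor_relations A B)"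
    and "T \<equiv> tensor_algebra A B"
begin

interpretation A: algebra "ring_of_type_algebra :: 'k ring" A by (rule A)
interpretation B: algebra "ring_of_type_algebra :: 'k ring" B by (rule B)

private lemma scalar_closed: "c \<in> carrier (ring_of_type_algebra :: 'k ring)"
  by (simp add: ring_of_type_algebra_def)

private lemma cring_P: "cring P"
  unfolding P_def
  by (intro cring_monoid_algebra comm_monoidI)
    (auto simp: DirProd_def A.m_assoc B.m_assoc intro: A.m_comm B.m_comm)

private lemma ideal_I: "ideal I P"
  using ring.genideal_ideal[OF cring.axioms(1)[OF cring_P]] tensor_relations_closed[OF A B]
  by (simp add: P_def I_def)

private lemma T_eq: "T = quotient_algebra P (\<lambda>c. Poly_Mapping.single (\<one>\<^bsub>A\<^esub>, \<one>\<^bsub>B\<^esub>) c) I"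
  by (simp add: T_def P_def I_def tensor_algebra_def)

private lemma cring_T: "cring T"
  using algebra_tensor_algebra[OF A B] by (simp add: T_def algebra_def)

private lemma proj_hom: "(+>\<^bsub>P\<^esub>) I \<in> ring_hom P T"
  unfolding T_eq by (rule quotient_algebra_proj_hom[OF ideal_I])

private lemma single_closed:
  "x \<in> carrier A \<Longrightarrow> y \<in> carrier B \<Longrightarrow> Poly_Mapping.single (x, y) c \<in> carrier P"
  by (simp add: P_def monoid_algebra_def DirProd_def)

private lemma add_P: "f \<oplus>\<^bsub>P\<^esub> g = f + g"
  by (simp add: P_def monoid_algebra_def)

private lemma mult_P: "Poly_Mapping.single (x, y) c \<otimes>\<^bsub>P\<^esub> Poly_Mapping.single (x', y') d
    = Poly_Mapping.single (x \<otimes>\<^bsub>A\<^esub> x', y \<otimes>\<^bsub>B\<^esub> y') (c * d)"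
  unfolding P_def monoid_algebra_mult_single by (simp add: DirProd_def)

private lemma proj_add:
  assumes "f \<in> carrier P" "g \<in> carrier P"
  shows "I +>\<^bsub>P\<^esub> (f + g) = (I +>\<^bsub>P\<^esub> f) \<oplus>\<^bsub>T\<^esub> (I +>\<^bsub>P\<^esub> g)"
  using ring_hom_add[OF proj_hom assms] by (simp add: add_P)

private lemma proj_eqI:
  assumes "f - g \<in> tensor_relations A B" "g \<in> carrier P"
  shows "I +>\<^bsub>P\<^esub> f = I +>\<^bsub>P\<^esub> g"
proof -
  interpret T: cring T by (rule cring_T)
  have rel: "tensor_relations A B \<subseteq> carrier P"
    unfolding P_def by (rule tensor_relations_closed[OF A B])
  have "f - g \<in> I"
    using ring.genideal_self[OF cring.axioms(1)[OF cring_P] rel] assms(1) by (auto simp: I_def P_def)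
  then have "I +>\<^bsub>P\<^esub> (f - g) = \<zero>\<^bsub>T\<^esub>"
    unfolding T_eq by (rule quotient_algebra_proj_eq_zero[OF ideal_I])
  \<comment> \<open>Membership in the carrier is at hand for \<open>f - g\<close>, as a relation,
    and for \<open>g\<close>; so \<open>f\<close> is rebuilt as their sum.\<close>
  then have "I +>\<^bsub>P\<^esub> ((f - g) + g) = I +>\<^bsub>P\<^esub> g"
    using proj_add[of "f - g" g] rel assms ring_hom_closed[OF proj_hom assms(2)] by auto
  then show ?thesis by simp
qed

private lemma pure: "pure_tensor A B x y = I +>\<^bsub>P\<^esub> Poly_Mapping.single (x, y) 1"
  by (simp add: pure_tensor_def P_def I_def)

lemma pure_tensor_closed:
  "x \<in> carrier A \<Longrightarrow> y \<in> carrier B \<Longrightarrow> pure_tensor A B x y \<in> carrier (tensor_algebra A B)"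
  using ring_hom_closed[OF proj_hom single_closed] by (simp add: pure T_def)

lemma pure_tensor_mult:
  assumes "x \<in> carrier A" "y \<in> carrier B" "x' \<in> carrier A" "y' \<in> carrier B"
  shows "pure_tensor A B x y \<otimes>\<^bsub>tensor_algebra A B\<^esub> pure_tensor A B x' y'
    = pure_tensor A B (x \<otimes>\<^bsub>A\<^esub> x') (y \<otimes>\<^bsub>B\<^esub> y')"
  using ring_hom_mult[OF proj_hom single_closed[OF assms(1,2)] single_closed[OF assms(3,4)], of 1 1]
  by (simp add: pure T_def mult_P)

lemma pure_tensor_one: "pure_tensor A B \<one>\<^bsub>A\<^esub> \<one>\<^bsub>B\<^esub> = \<one>\<^bsub>tensor_algebra A B\<^esub>"
  using ring_hom_one[OF proj_hom]
  by (simp add: pure T_def) (simp add: P_def monoid_algebra_def DirProd_def)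

lemma pure_tensor_add_left:
  assumes "x \<in> carrier A" "x' \<in> carrier A" "y \<in> carrier B"
  shows "pure_tensor A B (x \<oplus>\<^bsub>A\<^esub> x') y
    = pure_tensor A B x y \<oplus>\<^bsub>tensor_algebra A B\<^esub> pure_tensor A B x' y"
  unfolding pure T_def[symmetric] proj_add[OF single_closed single_closed, OF assms(1,3,2,3), symmetric]
proof (rule proj_eqI)
  show "Poly_Mapping.single (x \<oplus>\<^bsub>A\<^esub> x', y) 1 - (Poly_Mapping.single (x, y) 1 + Poly_Mapping.single (x', y) 1)
      \<in> tensor_relations A B"
    using assms unfolding tensor_relations_def diff_diff_eq[symmetric] by blast
  show "Poly_Mapping.single (x, y) 1 + Poly_Mapping.single (x', y) 1 \<in> carrier P"
    using cring.cring_simprules(1)[OF cring_P single_closed single_closed, OF assms(1,3,2,3), of 1 1]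
    by (simp add: add_P)
qed

lemma pure_tensor_add_right:
  assumes "x \<in> carrier A" "y \<in> carrier B" "y' \<in> carrier B"
  shows "pure_tensor A B x (y \<oplus>\<^bsub>B\<^esub> y')
    = pure_tensor A B x y \<oplus>\<^bsub>tensor_algebra A B\<^esub> pure_tensor A B x y'"
  unfolding pure T_def[symmetric] proj_add[OF single_closed single_closed, OF assms(1,2,1,3), symmetric]
proof (rule proj_eqI)
  show "Poly_Mapping.single (x, y \<oplus>\<^bsub>B\<^esub> y') 1 - (Poly_Mapping.single (x, y) 1 + Poly_Mapping.single (x, y') 1)
      \<in> tensor_relations A B"
    using assms unfolding tensor_relations_def diff_diff_eq[symmetric] by blast
  show "Poly_Mapping.single (x, y) 1 + Poly_Mapping.single (x, y') 1 \<in> carrier P"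
    using cring.cring_simprules(1)[OF cring_P single_closed single_closed, OF assms(1,2,1,3), of 1 1]
    by (simp add: add_P)
qed

text \<open>The relation for scalars in the left factor lets a coefficient be absorbed into that
  factor. Hence every basis element with a coefficient is congruent to an elementary tensor.\<close>

private lemma pure_smult_left:
  assumes "x \<in> carrier A" "y \<in> carrier B"
  shows "pure_tensor A B (c \<odot>\<^bsub>A\<^esub> x) y = I +>\<^bsub>P\<^esub> Poly_Mapping.single (x, y) c"
  unfolding pure
proof (rule proj_eqI)
  show "Poly_Mapping.single (c \<odot>\<^bsub>A\<^esub> x, y) 1 - Poly_Mapping.single (x, y) c \<in> tensor_relations A B"
    using assms unfolding tensor_relations_def by blast
qed (intro single_closed assms)

private lemma pure_smult_right:
  assumes "x \<in> carrier A" "y \<in> carrier B"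
  shows "pure_tensor A B x (c \<odot>\<^bsub>B\<^esub> y) = I +>\<^bsub>P\<^esub> Poly_Mapping.single (x, y) c"
  unfolding pure
proof (rule proj_eqI)
  show "Poly_Mapping.single (x, c \<odot>\<^bsub>B\<^esub> y) 1 - Poly_Mapping.single (x, y) c \<in> tensor_relations A B"
    using assms unfolding tensor_relations_def by blast
qed (intro single_closed assms)

private lemma smult_one_T:
  "c \<odot>\<^bsub>tensor_algebra A B\<^esub> \<one>\<^bsub>tensor_algebra A B\<^esub> = I +>\<^bsub>P\<^esub> Poly_Mapping.single (\<one>\<^bsub>A\<^esub>, \<one>\<^bsub>B\<^esub>) c"
  unfolding T_def[symmetric] T_eq
  by (rule quotient_algebra_smult_one[OF ideal_I]) (simp add: single_closed)

text \<open>Scalars entering through either factor become the scalars of the tensor product, so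
  agreement on those yields agreement on the scalars of both factors.\<close>

lemma pure_tensor_smult_one_left:
  "pure_tensor A B (c \<odot>\<^bsub>A\<^esub> \<one>\<^bsub>A\<^esub>) \<one>\<^bsub>B\<^esub> = c \<odot>\<^bsub>tensor_algebra A B\<^esub> \<one>\<^bsub>tensor_algebra A B\<^esub>"
  by (simp add: pure_smult_left smult_one_T)

lemma pure_tensor_smult_one_right:
  "pure_tensor A B \<one>\<^bsub>A\<^esub> (c \<odot>\<^bsub>B\<^esub> \<one>\<^bsub>B\<^esub>) = c \<odot>\<^bsub>tensor_algebra A B\<^esub> \<one>\<^bsub>tensor_algebra A B\<^esub>"
  by (simp add: pure_smult_right smult_one_T)

lemma pure_tensor_left_hom: "(\<lambda>x. pure_tensor A B x \<one>\<^bsub>B\<^esub>) \<in> ring_hom A (tensor_algebra A B)"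
  by (rule ring_hom_memI)
    (simp_all add: pure_tensor_closed pure_tensor_mult pure_tensor_add_left pure_tensor_one)

lemma pure_tensor_right_hom: "(\<lambda>y. pure_tensor A B \<one>\<^bsub>A\<^esub> y) \<in> ring_hom B (tensor_algebra A B)"
  by (rule ring_hom_memI)
    (simp_all add: pure_tensor_closed pure_tensor_mult pure_tensor_add_right pure_tensor_one)

text \<open>Elementary tensors generate the tensor product additively, and each is the product of
  one element from the left factor and one from the right.\<close>

lemma tensor_algebra_hom_unique:
  assumes F: "F \<in> ring_hom (tensor_algebra A B) S" and G: "G \<in> ring_hom (tensor_algebra A B) S"
    and left: "\<And>x. x \<in> carrier A \<Longrightarrow> F (pure_tensor A B x \<one>\<^bsub>B\<^esub>) = G (pure_tensor A B x \<one>\<^bsub>B\<^esub>)"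
    and right: "\<And>y. y \<in> carrier B \<Longrightarrow> F (pure_tensor A B \<one>\<^bsub>A\<^esub> y) = G (pure_tensor A B \<one>\<^bsub>A\<^esub> y)"
    and z: "z \<in> carrier (tensor_algebra A B)"
  shows "F z = G z"
proof -
  have pure_eq: "F (pure_tensor A B x y) = G (pure_tensor A B x y)"
    if "x \<in> carrier A" "y \<in> carrier B" for x y
  proof -
    have "pure_tensor A B x y
        = pure_tensor A B x \<one>\<^bsub>B\<^esub> \<otimes>\<^bsub>tensor_algebra A B\<^esub> pure_tensor A B \<one>\<^bsub>A\<^esub> y"
      using that by (simp add: pure_tensor_mult)
    then show ?thesis
      using that left right by (simp add: ring_hom_mult[OF F] ring_hom_mult[OF G] pure_tensor_closed)
  qed
  have single_eq: "F (I +>\<^bsub>P\<^esub> Poly_Mapping.single u c) = G (I +>\<^bsub>P\<^esub> Poly_Mapping.single u c)"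
    if "u \<in> carrier A \<times> carrier B" for u c
    using that pure_eq[of "c \<odot>\<^bsub>A\<^esub> fst u" "snd u"] A.smult_closed[OF scalar_closed, of "fst u" c]
    by (auto simp: pure_smult_left)
  \<comment> \<open>Membership in the carrier is carried through the induction because additivity of
    the projection requires it.\<close>
  have *: "(\<Sum>u\<in>K. Poly_Mapping.single u (c u)) \<in> carrier P \<and>
      F (I +>\<^bsub>P\<^esub> (\<Sum>u\<in>K. Poly_Mapping.single u (c u))) = G (I +>\<^bsub>P\<^esub> (\<Sum>u\<in>K. Poly_Mapping.single u (c u)))"
    if "finite K" "K \<subseteq> carrier A \<times> carrier B" for K and c :: "'a \<times> 'b \<Rightarrow> 'k"
    using that
  proof (induction K rule: finite_induct)
    \<comment> \<open>No ring axioms are assumed for \<open>S\<close>, so equality at zero is read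
      off from \<open>single_eq\<close>: zero is the basis element at the unit with coefficient
      0.\<close>
    case empty
    have "(0 :: 'a \<times> 'b \<Rightarrow>\<^sub>0 'k) \<in> carrier P"
      by (simp add: P_def monoid_algebra_def)
    then show ?case
      using single_eq[of "(\<one>\<^bsub>A\<^esub>, \<one>\<^bsub>B\<^esub>)" 0] by simp
  next
    case (insert u K)
    let ?s = "Poly_Mapping.single u (c u)" and ?S = "\<Sum>u\<in>K. Poly_Mapping.single u (c u)"
    have s: "?s \<in> carrier P" and S: "?S \<in> carrier P"
      using insert single_closed by auto
    have "?s + ?S \<in> carrier P"
      using cring.cring_simprules(1)[OF cring_P s S] by (simp add: add_P)
    moreover have "F (I +>\<^bsub>P\<^esub> (?s + ?S)) = G (I +>\<^bsub>P\<^esub> (?s + ?S))"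
      using insert single_eq ring_hom_closed[OF proj_hom s] ring_hom_closed[OF proj_hom S]
      by (simp add: proj_add s S ring_hom_add[OF F] ring_hom_add[OF G] T_def)
    ultimately show ?case using insert by simp
  qed
  obtain f where f: "f \<in> carrier P" "z = I +>\<^bsub>P\<^esub> f"
    using z unfolding T_def[symmetric] T_eq carrier_quotient_algebra by blast
  then have "Poly_Mapping.keys f \<subseteq> carrier A \<times> carrier B"
    by (simp add: P_def monoid_algebra_def DirProd_def)
  then show ?thesis
    using *[of "Poly_Mapping.keys f" "Poly_Mapping.lookup f"] f(2) by (simp add: sum_single_lookup)
qed

end


section \<open>Tangent directions on the product and on the surface\<close>

text \<open>The tensor product is generated by its two factors, and each circle by its scalars and
  two coordinates; scalars and four generators therefore suffice.\<close>

lemma circle_tensor_hom_unique: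
  fixes S (structure)
  defines "T \<equiv> tensor_algebra circle_algebra circle_algebra"
    and "pure \<equiv> pure_tensor circle_algebra circle_algebra"
    and "e \<equiv> \<one>\<^bsub>circle_algebra\<^esub>"
  assumes S: "cring S" and F: "F \<in> ring_hom T S" and G: "G \<in> ring_hom T S"
    and const: "\<And>c. F (c \<odot>\<^bsub>T\<^esub> \<one>\<^bsub>T\<^esub>) = G (c \<odot>\<^bsub>T\<^esub> \<one>\<^bsub>T\<^esub>)"
    and left: "F (pure circle_a e) = G (pure circle_a e)" "F (pure circle_b e) = G (pure circle_b e)"
    and right: "F (pure e circle_a) = G (pure e circle_a)" "F (pure e circle_b) = G (pure e circle_b)"
    and z: "z \<in> carrier T"
  shows "F z = G z"
proof -
  note circle = algebra_circle_algebra algebra_circle_algebra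
  note L = pure_tensor_left_hom[OF circle] and R = pure_tensor_right_hom[OF circle]
  show ?thesis
  proof (rule tensor_algebra_hom_unique[OF circle F[unfolded T_def] G[unfolded T_def] _ _ z[unfolded T_def]])
    fix x assume x: "x \<in> carrier circle_algebra"
    show "F (pure_tensor circle_algebra circle_algebra x \<one>\<^bsub>circle_algebra\<^esub>)
        = G (pure_tensor circle_algebra circle_algebra x \<one>\<^bsub>circle_algebra\<^esub>)"
      using circle_hom_unique[OF S ring_hom_trans[OF L F[unfolded T_def]]
          ring_hom_trans[OF L G[unfolded T_def]] _ _ _ x] const left
      by (simp add: T_def pure_def e_def pure_tensor_smult_one_left[OF circle])
    show "F (pure_tensor circle_algebra circle_algebra \<one>\<^bsub>circle_algebra\<^esub> x)
        = G (pure_tensor circle_algebra circle_algebra \<one>\<^bsub>circle_algebra\<^esub> x)"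
      using circle_hom_unique[OF S ring_hom_trans[OF R F[unfolded T_def]]
          ring_hom_trans[OF R G[unfolded T_def]] _ _ _ x] const right
      by (simp add: T_def pure_def e_def pure_tensor_smult_one_right[OF circle])
  qed
qed

text \<open>Differentiating the circle equation gives \<open>a *s v + b *s u = 0\<close>, whose
  solutions are multiples of \<open>(b, -a)\<close>. The common vector is
  \<open>b *s v - a *s u\<close>, and \<open>a * a + b * b = 1\<close> confirms that it yields
  \<open>v\<close> and \<open>u\<close> with factors \<open>b\<close> and
  \<open>- a\<close>.\<close>

lemma circle_hom_tangent_proportional:
  assumes "f \<in> ring_hom circle_algebra (thick_point :: (complex \<times> (complex ^ 'n)) ring)"
  shows "\<exists>w c d. snd (f circle_a) = c *s w \<and> snd (f circle_b) = d *s w"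
proof -
  obtain a v b u where ab: "f circle_a = (a, v)" "f circle_b = (b, u)"
    by (metis surj_pair)
  have unit: "a * a + b * b = 1" and tangent: "a *s v + a *s v + (b *s u + b *s u) = 0"
    using circle_hom_relation[OF cring_thick_point assms] by (auto simp: thick_point_def ab)
  have t: "b * u $ i = - (a * v $ i)" for i
  proof -
    \<comment> \<open>Squaring in \<open>thick_point\<close> doubles the mixed terms; the factor 2
      cancels over \<complex>.\<close>
    have "2 * (a * v $ i + b * u $ i) = 0"
      using arg_cong[OF tangent, of "\<lambda>x. x $ i"] by (simp add: algebra_simps)
    then show ?thesis
      unfolding mult_eq_0_iff by (simp add: eq_neg_iff_add_eq_0 add.commute)
  qed
  have "v $ i = b * (b * v $ i - a * u $ i)" "u $ i = - a * (b * v $ i - a * u $ i)" for i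
  proof -
    have "b * (b * v $ i - a * u $ i) = b * b * v $ i - a * (b * u $ i)"
      by (simp add: algebra_simps)
    also have "\<dots> = (a * a + b * b) * v $ i"
      unfolding t by (simp add: algebra_simps)
    finally show "v $ i = b * (b * v $ i - a * u $ i)"
      using unit by simp
    have "- a * (b * v $ i - a * u $ i) = a * a * u $ i + b * - (a * v $ i)"
      by (simp add: algebra_simps)
    also have "\<dots> = (a * a + b * b) * u $ i"
      unfolding t[symmetric] by (simp add: algebra_simps)
    finally show "u $ i = - a * (b * v $ i - a * u $ i)"
      using unit by simp
  qed
  then have "v = b *s (b *s v - a *s u)" "u = (- a) *s (b *s v - a *s u)"
    by (simp_all add: vec_eq_iff)
  then show ?thesis
    unfolding ab snd_conv by blast
qed

text \<open>At this point \<open>x\<close>, \<open>y\<close> and \<open>a + 2\<close> all have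
  complex part zero, so their squares vanish and the surface equation puts no condition on their
  tangent parts. Two directions come from \<open>x\<close> and \<open>y\<close>, the third from the
  tangent line of the circle.\<close>

lemma surface_singular_point:
  "\<exists>F\<in>ring_hom surface_algebra (thick_point :: (complex \<times> (complex ^ 3)) ring).
    (\<forall>c. F (c \<odot>\<^bsub>surface_algebra\<^esub> \<one>\<^bsub>surface_algebra\<^esub>) = (complex_of_real c, 0)) \<and>
    (\<forall>i. axis i 1 \<in> snd ` F ` carrier surface_algebra)"
proof -
  let ?S = "thick_point :: (complex \<times> (complex ^ 3)) ring"
  define \<beta> where "\<beta> = \<i> * complex_of_real (sqrt 3)"
  \<comment> \<open>The complex parts solve the circle equation since 4 - 3 = 1. The tangent parts
    solve its linearisation, -2 times the first plus \<open>\<beta>\<close> times the second being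
    zero, normalised so that \<open>t\<close> has tangent part \<open>axis 3 1\<close>.\<close>
  define s t :: "complex \<times> (complex ^ 3)" where "s = (-2, axis 3 (\<beta> / 2))" and "t = (\<beta>, axis 3 1)"
  have \<beta>: "\<beta> * \<beta> = -3"
    by (simp add: \<beta>_def power2_eq_square[symmetric] power_mult_distrib flip: of_real_power)
  have carrier: "z \<in> carrier ?S" for z
    by (simp add: thick_point_def)
  have "(\<lambda>c. (complex_of_real c, 0)) \<in> ring_hom real_ring ?S"
    by (rule ring_hom_memI) (simp_all add: thick_point_def ring_of_type_algebra_def)
  moreover have "s \<otimes>\<^bsub>?S\<^esub> s \<oplus>\<^bsub>?S\<^esub> t \<otimes>\<^bsub>?S\<^esub> t = \<one>\<^bsub>?S\<^esub>"
    by (simp add: thick_point_def s_def t_def \<beta> vec_eq_iff axis_def)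
  ultimately obtain f where f: "f \<in> ring_hom circle_algebra ?S"
    "\<And>c. f (c \<odot>\<^bsub>circle_algebra\<^esub> \<one>\<^bsub>circle_algebra\<^esub>) = (complex_of_real c, 0)"
    "f circle_a = s" "f circle_b = t"
    using circle_hom_exists[OF cring_thick_point _ carrier carrier] by blast
  let ?x = "(0, axis 1 1) :: complex \<times> (complex ^ 3)" and ?y = "(0, axis 2 1) :: complex \<times> (complex ^ 3)"
  have "?x \<otimes>\<^bsub>?S\<^esub> ?x \<oplus>\<^bsub>?S\<^esub> ?y \<otimes>\<^bsub>?S\<^esub> ?y =
      (f circle_a \<oplus>\<^bsub>?S\<^esub> (\<one>\<^bsub>?S\<^esub> \<oplus>\<^bsub>?S\<^esub> \<one>\<^bsub>?S\<^esub>)) \<otimes>\<^bsub>?S\<^esub> (f circle_a \<oplus>\<^bsub>?S\<^esub> (\<one>\<^bsub>?S\<^esub> \<oplus>\<^bsub>?S\<^esub> \<one>\<^bsub>?S\<^esub>))"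
    by (simp add: thick_point_def f s_def)
  from surface_hom_exists[OF cring_thick_point f(1) carrier carrier this]
  obtain F where F: "F \<in> ring_hom surface_algebra ?S"
    "\<And>c. F (c \<odot>\<^bsub>surface_algebra\<^esub> \<one>\<^bsub>surface_algebra\<^esub>) = (complex_of_real c, 0)"
    "f ` carrier circle_algebra \<union> {?x, ?y} \<subseteq> F ` carrier surface_algebra"
    using f(2) by auto
  have "{t, ?x, ?y} \<subseteq> F ` carrier surface_algebra"
    using F(3) f(4) circle_b_closed by blast
  then have "snd ` {t, ?x, ?y} \<subseteq> snd ` F ` carrier surface_algebra"
    by (rule image_mono)
  then have "\<forall>i. axis i 1 \<in> snd ` F ` carrier surface_algebra"
    by (simp add: t_def forall_3)
  with F show ?thesis by blast
qed

section \<open>Nonexistence of an isomorphism\<close>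

theorem proposition4p1:
  shows "algebra_iso real_ring surface_algebra (tensor_algebra circle_algebra circle_algebra) = {}"
proof (rule equals0I)
  let ?A = surface_algebra and ?T = "tensor_algebra circle_algebra circle_algebra"
  let ?S = "thick_point :: (complex \<times> (complex ^ 3)) ring"
  let ?pure = "pure_tensor circle_algebra circle_algebra" and ?e = "\<one>\<^bsub>circle_algebra\<^esub>"
  note circle = algebra_circle_algebra algebra_circle_algebra
  fix h assume h: "h \<in> algebra_iso real_ring ?A ?T"
  interpret A: algebra real_ring ?A by (rule algebra_surface_algebra)
  define \<psi> where "\<psi> = inv_into (carrier ?A) h"
  have h_iso: "h \<in> ring_iso ?A ?T"
    using h by (simp add: algebra_iso_def)
  then have h_hom: "h \<in> ring_hom ?A ?T" and h_bij: "bij_betw h (carrier ?A) (carrier ?T)"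
    by (simp_all add: ring_iso_def)
  have \<psi>_hom: "\<psi> \<in> ring_hom ?T ?A"
    using ring_iso_set_sym[OF cring.axioms(1)[OF A.M_cring] h_iso] by (simp add: \<psi>_def ring_iso_def)
  have \<psi>_h: "\<psi> (h x) = x" if "x \<in> carrier ?A" for x
    using bij_betw_inv_into_left[OF h_bij that] by (simp add: \<psi>_def)
  have \<psi>_const: "\<psi> (c \<odot>\<^bsub>?T\<^esub> \<one>\<^bsub>?T\<^esub>) = c \<odot>\<^bsub>?A\<^esub> \<one>\<^bsub>?A\<^esub>" for c
  proof -
    have "h (c \<odot>\<^bsub>?A\<^esub> \<one>\<^bsub>?A\<^esub>) = c \<odot>\<^bsub>?T\<^esub> \<one>\<^bsub>?T\<^esub>"
      using h carrier_real_ring by (simp add: algebra_iso_def ring_hom_one[OF h_hom])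
    then show ?thesis
      using \<psi>_h[of "c \<odot>\<^bsub>?A\<^esub> \<one>\<^bsub>?A\<^esub>"] carrier_real_ring by simp
  qed
  obtain F where F: "F \<in> ring_hom ?A ?S"
    "\<And>c. F (c \<odot>\<^bsub>?A\<^esub> \<one>\<^bsub>?A\<^esub>) = (complex_of_real c, 0)"
    "\<And>i. axis i 1 \<in> snd ` F ` carrier ?A"
    using surface_singular_point by auto
  have G: "F \<circ> \<psi> \<in> ring_hom ?T ?S"
    by (rule ring_hom_trans[OF \<psi>_hom F(1)])
  obtain v c d where v: "snd ((F \<circ> \<psi>) (?pure circle_a ?e)) = c *s v"
      "snd ((F \<circ> \<psi>) (?pure circle_b ?e)) = d *s v"
    using circle_hom_tangent_proportional[OF ring_hom_trans[OF pure_tensor_left_hom[OF circle] G]] by auto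
  obtain w c' d' where w: "snd ((F \<circ> \<psi>) (?pure ?e circle_a)) = c' *s w"
      "snd ((F \<circ> \<psi>) (?pure ?e circle_b)) = d' *s w"
    using circle_hom_tangent_proportional[OF ring_hom_trans[OF pure_tensor_right_hom[OF circle] G]] by auto
  \<comment> \<open>Each circle factor contributes tangent parts along one vector only,
    \<open>v\<close> or \<open>w\<close>, so one nonzero form kills all four generators.\<close>
  obtain M :: "complex ^ 3 ^ 1" where M: "M \<noteq> 0" "M *v v = 0" "M *v w = 0"
    using exists_linear_form_vanishing by blast
  \<comment> \<open>\<open>H N\<close> applies \<open>N\<close> to the tangent parts of
    \<open>F \<circ> \<psi>\<close>; thus \<open>H M\<close> and \<open>H 0\<close> agree exactly
    where \<open>M\<close> kills the tangent part.\<close>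
  define H :: "complex ^ 3 ^ 1 \<Rightarrow> _" where "H N = (\<lambda>(c, u). (c, N *v u)) \<circ> (F \<circ> \<psi>)" for N
  have H_hom: "H N \<in> ring_hom ?T thick_point" for N
    unfolding H_def by (rule ring_hom_trans[OF G thick_point_linear_hom])
  have H_eqI: "H M z = H 0 z" if "M *v snd ((F \<circ> \<psi>) z) = 0" for z
    using that by (simp add: H_def case_prod_beta)
  \<comment> \<open>Agreement has to be checked on scalars, whose tangent part is zero, and on the
    four generators, whose tangent parts are multiples of \<open>v\<close> or
    \<open>w\<close>.\<close>
  have H_eq: "H M z = H 0 z" if "z \<in> carrier ?T" for z
    by (rule circle_tensor_hom_unique[OF cring_thick_point H_hom H_hom _ _ _ _ _ that];
        rule H_eqI) (simp_all only: v w vector_scalar_commute M vector_smult_rzero,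
          simp add: \<psi>_const F(2))
  \<comment> \<open>The vector \<open>axis i 1\<close> is the tangent part of some
    \<open>F x\<close>, which is the value of \<open>F \<circ> \<psi>\<close> at \<open>h x\<close>;
    so \<open>M\<close> kills a basis and must be zero.\<close>
  have "M *v axis i 1 = 0" for i
  proof -
    obtain x where x: "x \<in> carrier ?A" "axis i 1 = snd (F x)"
      using F(3)[of i] by auto
    show ?thesis
      using H_eq[OF ring_hom_closed[OF h_hom x(1)]] by (simp add: H_def case_prod_beta \<psi>_h x)
  qed
  then have "M = 0"
    by (simp add: matrix_vector_mult_def axis_def vec_eq_iff if_distrib[of "(*) _"] cong: if_cong)
  with M(1) show False by contradiction
qed

end
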